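(* Let $X$ be a Banach space and let $T\in B(X)$ be a hypercyclic operator with $c(T)>0$. Then $T$ is reiteratively distributionally chaotic of type $1$.
   Context: $B(X)$ is the space of bounded linear operators $X\to X$. $T$ is hypercyclic if some $x\in X$ has the property that for every nonempty open $U\subset X$ the set $\{n\in\mathbb N:T^nx\in U\}$ is nonempty; such $x$ is a hypercyclic vector and $HC(T)$ denotes the set of all hypercyclic vectors for $T$. For $A\subset\mathbb N$: $\overline{\mathrm{dens}}(A)=\limsup_{n\to\infty}\frac{\mathrm{card}(A\cap[1,n])}{n}$ and $\underline{\mathrm{Bd}}(A)=\lim_{n\to\infty}\liminf_{m\to\infty}\frac{\mathrm{card}(A\cap[m+1,m+n])}{n}$. For hypercyclic $T$, $c(T):=\sup_{x\in HC(T)}\overline{\mathrm{dens}}\{n\in\mathbb N:T^nx\in B(0,a)\}\in[0,1]$, where $a>0$ and $B(0,a)$ is the ball of radius $a$ centered at $0$; by linearity the value does not depend on $a$. For $x,y\in X$ and $\delta>0$ put $D_{x,y}(\delta)=\{j\in\mathbb N:\|T^jx-T^jy\|<\delta\}$, $F^*_{x,y}(\delta)=\overline{\mathrm{dens}}(D_{x,y}(\delta))$, $BF_{x,y}(\delta)=\underline{\mathrm{Bd}}(D_{x,y}(\delta))$. $T$ is reiteratively distributionally chaotic of type $1$ if there exist an uncountable set $\Gamma\subset X$ and $\varepsilon>0$ such that for all distinct $x,y\in\Gamma$, $BF_{x,y}(\varepsilon)=0$ and there exist $c>0$ and $r>0$ with $c\le F^*_{x,y}(\delta)$ for all $0<\delta<r$.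 *)

theory Defs
  imports "HOL-Analysis.Analysis"
begin

text \<open>
  Operators are plain functions on a type of class \<open>banach\<close>; boundedness and linearity are
  assumed separately through \<open>bounded_linear\<close>. A complex Banach space is covered via its
  underlying real one, since none of the notions below mentions the scalar field.

  Times range over all of \<open>nat\<close>. The densities only count positive integers, and on a nonzero
  space whether time \<open>0\<close> is allowed makes no difference to hypercyclicity either.
\<close>

definition hypercyclic_vector :: "('a::banach \<Rightarrow> 'a) \<Rightarrow> 'a \<Rightarrow> bool" where
  "hypercyclic_vector T x \<longleftrightarrow> (\<forall>U. open U \<and> U \<noteq> {} \<longrightarrow> {n. (T ^^ n) x \<in> U} \<noteq> {})"

definition HC :: "('a::banach \<Rightarrow> 'a) \<Rightarrow> 'a set" where
  "HC T = {x. hypercyclic_vector T x}"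

definition hypercyclic :: "('a::banach \<Rightarrow> 'a) \<Rightarrow> bool" where
  "hypercyclic T \<longleftrightarrow> (\<exists>x. hypercyclic_vector T x)"

definition upper_density :: "nat set \<Rightarrow> ereal" where
  "upper_density A = limsup (\<lambda>n. ereal (real (card (A \<inter> {1..n})) / real n))"

text \<open>
  The outer limit always exists: the inner lower limit of the unnormalised counts is
  superadditive in \<open>n\<close> (Fekete).
\<close>

definition lower_Banach_density :: "nat set \<Rightarrow> ereal" where
  "lower_Banach_density A =
    lim (\<lambda>n. liminf (\<lambda>m. ereal (real (card (A \<inter> {m+1..m+n})) / real n)))"

text \<open>
  The constant $c(T)$, with the radius of the ball fixed to be \<open>1\<close>; by the lemma
  \<open>hc_const_radius\<close> below every other radius gives the same value.
\<close>

definition hc_const :: "('a::banach \<Rightarrow> 'a) \<Rightarrow> ereal" where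
  "hc_const T = (SUP x\<in>HC T. upper_density {n. (T ^^ n) x \<in> ball 0 1})"

definition dist_times :: "('a::banach \<Rightarrow> 'a) \<Rightarrow> 'a \<Rightarrow> 'a \<Rightarrow> real \<Rightarrow> nat set" where
  "dist_times T x y \<delta> = {j. norm ((T ^^ j) x - (T ^^ j) y) < \<delta>}"

definition F_star :: "('a::banach \<Rightarrow> 'a) \<Rightarrow> 'a \<Rightarrow> 'a \<Rightarrow> real \<Rightarrow> ereal" where
  "F_star T x y \<delta> = upper_density (dist_times T x y \<delta>)"

definition BF :: "('a::banach \<Rightarrow> 'a) \<Rightarrow> 'a \<Rightarrow> 'a \<Rightarrow> real \<Rightarrow> ereal" where
  "BF T x y \<delta> = lower_Banach_density (dist_times T x y \<delta>)"

definition reiteratively_distributionally_chaotic_1 :: "('a::banach \<Rightarrow> 'a) \<Rightarrow> bool" where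
  "reiteratively_distributionally_chaotic_1 T \<longleftrightarrow>
    (\<exists>\<Gamma> \<epsilon>. uncountable \<Gamma> \<and> \<epsilon> > 0 \<and>
      (\<forall>x\<in>\<Gamma>. \<forall>y\<in>\<Gamma>. x \<noteq> y \<longrightarrow>
        BF T x y \<epsilon> = 0 \<and>
        (\<exists>c>0. \<exists>r>0. \<forall>\<delta>. 0 < \<delta> \<and> \<delta> < r \<longrightarrow> ereal c \<le> F_star T x y \<delta>)))"

lemma funpow_scaleR:
  fixes T :: "'a::banach \<Rightarrow> 'a"
  assumes "linear T"
  shows "(T ^^ n) (s *\<^sub>R x) = s *\<^sub>R (T ^^ n) x"
  by (induction n) (simp_all add: linear_scale[OF assms])

lemma HC_scaleR:
  assumes "linear T" "x \<in> HC T" "s \<noteq> 0"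
  shows "s *\<^sub>R x \<in> HC T"
  unfolding HC_def hypercyclic_vector_def mem_Collect_eq
proof (intro allI impI)
  fix U :: "'a set" assume U: "open U \<and> U \<noteq> {}"
  have "open ((*\<^sub>R) (inverse s) ` U)" "(*\<^sub>R) (inverse s) ` U \<noteq> {}"
    using U assms(3) by (auto intro: open_scaling)
  then obtain n where "(T ^^ n) x \<in> (*\<^sub>R) (inverse s) ` U"
    using assms(2) unfolding HC_def hypercyclic_vector_def by blast
  then have "(T ^^ n) (s *\<^sub>R x) \<in> U"
    using assms(3) by (auto simp: funpow_scaleR[OF assms(1)])
  then show "{n. (T ^^ n) (s *\<^sub>R x) \<in> U} \<noteq> {}" by blast
qed

lemma hc_const_radius:
  assumes "linear T" "a > 0"
  shows "hc_const T = (SUP x\<in>HC T. upper_density {n. (T ^^ n) x \<in> ball 0 a})"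
proof -
  have img: "(*\<^sub>R) a ` HC T = HC T"
  proof
    show "(*\<^sub>R) a ` HC T \<subseteq> HC T" using HC_scaleR[OF assms(1)] assms(2) by auto
    show "HC T \<subseteq> (*\<^sub>R) a ` HC T"
    proof
      fix x assume "x \<in> HC T"
      then have "inverse a *\<^sub>R x \<in> HC T" using HC_scaleR[OF assms(1)] assms(2) by auto
      moreover have "x = a *\<^sub>R (inverse a *\<^sub>R x)" using assms(2) by simp
      ultimately show "x \<in> (*\<^sub>R) a ` HC T" by blast
    qed
  qed
  have "(SUP x\<in>HC T. upper_density {n. (T ^^ n) x \<in> ball 0 a})
      = (SUP x\<in>(*\<^sub>R) a ` HC T. upper_density {n. (T ^^ n) x \<in> ball 0 a})"
    by (simp only: img)
  also have "\<dots> = (SUP x\<in>HC T. upper_density {n. (T ^^ n) (a *\<^sub>R x) \<in> ball 0 a})"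
    by (simp add: image_image)
  also have "\<dots> = hc_const T"
    unfolding hc_const_def using assms(2) by (simp add: funpow_scaleR[OF assms(1)])
  finally show ?thesis by simp
qed

end

theory Submission
  imports Defs
begin

text \<open>
  A Baire category argument produces one vector \<open>x\<close> whose multiples form the required set.
  Entering every ball around \<open>0\<close> with a fixed upper frequency, and having arbitrarily long
  stretches of the orbit with arbitrarily large norm, are both countable intersections of open
  conditions. Each of the open sets is dense: the first kind contains the whole orbit of a
  hypercyclic vector nearly realizing $c(T)$ for the given radius, the second kind the orbit of
  any hypercyclic vector. Both conditions pass from \<open>x\<close> to all multiples \<open>s x\<close> with
  \<open>s \<noteq> 0\<close>, hence to all differences of distinct multiples of \<open>x\<close>.
\<close>

section \<open>Upper density and lower Banach density\<close>

lemma upper_density_gtD: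
  assumes "ereal c < upper_density A"
  shows "\<exists>n\<ge>N. 0 < n \<and> c * real n < real (card (A \<inter> {1..n}))"
proof (rule ccontr)
  assume no: "\<not> ?thesis"
  have "\<forall>\<^sub>F n in sequentially. ereal (real (card (A \<inter> {1..n})) / real n) \<le> ereal c"
    \<comment> \<open>The lower bound 1 keeps \<open>n\<close> positive, so the quotient by
      \<open>n\<close> is a genuine one.\<close>
    using eventually_ge_at_top[of "max N 1"]
  proof eventually_elim
    case (elim n)
    then have "real (card (A \<inter> {1..n})) \<le> c * real n" using no by force
    then show ?case using elim by (simp add: divide_le_eq)
  qed
  then have "upper_density A \<le> ereal c"
    unfolding upper_density_def by (rule Limsup_bounded)
  then show False using assms by simp
qed

lemma upper_density_geI:
  assumes "\<And>N. \<exists>n\<ge>N. 0 < n \<and> c * real n \<le> real (card (A \<inter> {1..n}))"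
  shows "ereal c \<le> upper_density A"
proof (rule ccontr)
  assume "\<not> ?thesis"
  then have "\<forall>\<^sub>F n in sequentially. ereal (real (card (A \<inter> {1..n})) / real n) < ereal c"
    unfolding upper_density_def by (intro Limsup_lessD) simp
  then obtain N where N: "\<And>n. n \<ge> N \<Longrightarrow> real (card (A \<inter> {1..n})) / real n < c"
    unfolding eventually_sequentially by auto
  obtain n where "n \<ge> N" "0 < n" "c * real n \<le> real (card (A \<inter> {1..n}))"
    using assms by blast
  with N[of n] show False by (simp add: divide_less_eq)
qed

lemma upper_density_mono:
  assumes "A \<subseteq> B"
  shows "upper_density A \<le> upper_density B"
proof -
  have "card (A \<inter> {1..n}) \<le> card (B \<inter> {1..n})" for n
    using assms by (intro card_mono) auto
  then show ?thesis
    unfolding upper_density_def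
    by (intro Limsup_mono always_eventually allI) (simp add: divide_right_mono)
qed

text \<open>Gaps of every length make the inner lower limit vanish for each window length
  \<open>n\<close>, including \<open>n = 0\<close>, where the quotient is 0 by convention. The outer
  limit is then that of a constant sequence.\<close>

lemma lower_Banach_density_eq_0I:
  assumes "\<And>n. \<exists>m. A \<inter> {m+1..m+n} = {}"
  shows "lower_Banach_density A = 0"
proof -
  have "liminf (\<lambda>m. ereal (real (card (A \<inter> {m+1..m+n})) / real n)) = 0" (is "liminf ?f = 0") for n
  proof (rule antisym)
    have freq: "\<exists>m\<ge>M. ?f m = 0" for M
    proof -
      \<comment> \<open>A gap of length \<open>n + M\<close> contains one of length \<open>n\<close> lying beyond \<open>M\<close>.\<close>
      obtain m where "A \<inter> {m+1..m+(n+M)} = {}" using assms by blast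
      then have "A \<inter> {(m+M)+1..(m+M)+n} = {}" by fastforce
      then show ?thesis by (intro exI[of _ "m+M"]) simp
    qed
    show "liminf ?f \<le> 0"
      unfolding Liminf_def
    proof (rule SUP_least)
      fix P :: "nat \<Rightarrow> bool"
      assume "P \<in> {P. eventually P sequentially}"
      then obtain M where M: "\<And>m. m \<ge> M \<Longrightarrow> P m" by (auto simp: eventually_sequentially)
      obtain m where "m \<ge> M" "?f m = 0" using freq by blast
      then show "(INF m\<in>Collect P. ?f m) \<le> 0"
        using M by (intro INF_lower2[of m]) auto
    qed
    show "0 \<le> liminf ?f" by (intro Liminf_bounded always_eventually allI) simp
  qed
  then show ?thesis
    unfolding lower_Banach_density_def by (simp add: limI)
qed

section \<open>Baire category and orbits of hypercyclic vectors\<close>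

lemma Baire_nat:
  fixes G :: "nat \<Rightarrow> 'a::complete_space set"
  assumes "\<And>n. open (G n)" "\<And>n. closure (G n) = UNIV"
  shows "closure (\<Inter>n. G n) = UNIV"
proof -
  have "euclidean closure_of \<Inter>(range G) = topspace (euclidean :: 'a topology)"
    by (rule Baire_category) (use assms in \<open>auto simp: completely_metrizable_space_euclidean\<close>)
  then show ?thesis by simp
qed

lemma bounded_linear_funpow:
  fixes T :: "'a::real_normed_vector \<Rightarrow> 'a"
  assumes "bounded_linear T"
  shows "bounded_linear (T ^^ n)"
proof (induction n)
  case 0
  show ?case using bounded_linear_ident by (simp add: id_def)
next
  case (Suc n)
  show ?case using bounded_linear_compose[OF assms Suc] by (simp add: o_def)
qed

lemma open_norm_funpow:
  fixes T :: "'a::real_normed_vector \<Rightarrow> 'a"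
  assumes "bounded_linear T"
  shows "open {x. r < norm ((T ^^ n) x)}" "open {x. norm ((T ^^ n) x) < r}"
proof -
  have "continuous_on UNIV (\<lambda>x. norm ((T ^^ n) x))"
    by (intro continuous_on_norm linear_continuous_on bounded_linear_funpow assms)
  then show "open {x. r < norm ((T ^^ n) x)}" "open {x. norm ((T ^^ n) x) < r}"
    by (simp_all add: open_Collect_less continuous_on_const)
qed

lemma hypercyclic_vector_closure_orbit:
  assumes "hypercyclic_vector T x"
  shows "closure (range (\<lambda>p. (T ^^ p) x)) = UNIV"
proof (rule ccontr)
  let ?U = "- closure (range (\<lambda>p. (T ^^ p) x))"
  assume "\<not> ?thesis"
  then have "open ?U \<and> ?U \<noteq> {}" by (auto simp: open_Compl)
  then have "{p. (T ^^ p) x \<in> ?U} \<noteq> {}"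
    using assms unfolding hypercyclic_vector_def by (elim allE[of _ ?U]) (erule mp)
  moreover have "(T ^^ p) x \<notin> ?U" for p
    using subsetD[OF closure_subset rangeI[of "\<lambda>p. (T ^^ p) x" p]] by simp
  ultimately show False by simp
qed

text \<open>An orbit that meets 0 stays there, so it is finite and hence closed. Being dense as
  well, it would be the whole space, yet a nonzero real space contains an infinite line.\<close>

lemma hypercyclic_vector_orbit_nonzero:
  fixes T :: "'a::banach \<Rightarrow> 'a"
  assumes nontrivial: "\<exists>x::'a. x \<noteq> 0"
    and T: "bounded_linear T" and x: "hypercyclic_vector T x"
  shows "(T ^^ n) x \<noteq> 0"
proof
  assume 0: "(T ^^ n) x = 0"
  have later: "(T ^^ j) x = 0" if "j \<ge> n" for j
  proof -
    have "(T ^^ j) x = (T ^^ (j - n)) ((T ^^ n) x)"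
      using that funpow_add[of "j - n" n T] by simp
    then show ?thesis
      using 0 linear_0[OF bounded_linear.linear[OF bounded_linear_funpow[OF T]]] by simp
  qed
  have "range (\<lambda>p. (T ^^ p) x) \<subseteq> insert 0 ((\<lambda>p. (T ^^ p) x) ` {..<n})"
  proof clarify
    fix p assume "(T ^^ p) x \<notin> (\<lambda>p. (T ^^ p) x) ` {..<n}"
    then have "p \<ge> n" by (cases "p < n") auto
    then show "(T ^^ p) x = 0" by (rule later)
  qed
  then have "finite (range (\<lambda>p. (T ^^ p) x))" by (rule finite_subset) simp
  from closure_closed[OF finite_imp_closed[OF this]] this have "finite (UNIV :: 'a set)"
    unfolding hypercyclic_vector_closure_orbit[OF x] by simp
  then have "finite (range (\<lambda>s::real. s *\<^sub>R v))" for v :: 'a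
    by (rule finite_subset[OF subset_UNIV])
  moreover obtain v :: 'a where "v \<noteq> 0" using nontrivial by blast
  then have "inj (\<lambda>s::real. s *\<^sub>R v)" by (simp add: inj_on_def)
  ultimately show False
    using finite_imageD infinite_UNIV_char_0[where 'a = real] by blast
qed

section \<open>Open sets of long excursions and of frequent returns\<close>

text \<open>The one parameter \<open>n\<close> is both the length of the stretch and the height
  exceeded on it. Starting at \<open>j = 1\<close> matches the windows \<open>{m+1..m+n}\<close> of
  the lower Banach density.\<close>

definition long_excursion_set :: "('a::banach \<Rightarrow> 'a) \<Rightarrow> nat \<Rightarrow> 'a set" where
  "long_excursion_set T n = (\<Union>m. \<Inter>j\<in>{1..n}. {x. norm ((T ^^ (m + j)) x) > real n})"

text \<open>Intersecting over all \<open>N\<close> turns the witness \<open>n \<ge> N\<close> into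
  the statement that the upper density is at least \<open>c\<close>.\<close>

definition frequent_return_set :: "('a::banach \<Rightarrow> 'a) \<Rightarrow> real \<Rightarrow> real \<Rightarrow> nat \<Rightarrow> 'a set" where
  "frequent_return_set T c a N =
    {x. \<exists>n\<ge>N. 0 < n \<and> c * real n < real (card ({j. norm ((T ^^ j) x) < a} \<inter> {1..n}))}"

lemma open_long_excursion_set:
  assumes "bounded_linear T"
  shows "open (long_excursion_set T n)"
  unfolding long_excursion_set_def
  by (intro open_UN open_INT ballI finite_atLeastAtMost open_norm_funpow assms)

text \<open>The count exceeds \<open>c * real n\<close> iff some large enough finite set
  \<open>S\<close> of times has all its iterates in the open ball. For fixed \<open>S\<close> this
  is a finite intersection of open conditions.\<close>

lemma open_frequent_return_set:
  assumes T: "bounded_linear T"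
  shows "open (frequent_return_set T c a N)"
proof -
  have "frequent_return_set T c a N = (\<Union>n\<in>{n. n \<ge> N \<and> 0 < n}.
      \<Union>S\<in>{S. S \<subseteq> {1..n} \<and> c * real n < real (card S)}. \<Inter>j\<in>S. {x. norm ((T ^^ j) x) < a})"
    (is "_ = ?U")
  proof (intro set_eqI iffI)
    fix x assume "x \<in> frequent_return_set T c a N"
    then obtain n where "n \<ge> N" "0 < n"
      "c * real n < real (card ({j. norm ((T ^^ j) x) < a} \<inter> {1..n}))"
      unfolding frequent_return_set_def by blast
    then show "x \<in> ?U"
      by (intro UN_I[of n] UN_I[of "{j. norm ((T ^^ j) x) < a} \<inter> {1..n}"]) auto
  next
    fix x assume "x \<in> ?U"
    then obtain n S where n: "n \<ge> N" "0 < n" and S: "S \<subseteq> {1..n}" "c * real n < real (card S)"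
      and small: "\<And>j. j \<in> S \<Longrightarrow> norm ((T ^^ j) x) < a" by auto
    have "card S \<le> card ({j. norm ((T ^^ j) x) < a} \<inter> {1..n})"
      using S small by (intro card_mono) auto
    then show "x \<in> frequent_return_set T c a N"
      using n S unfolding frequent_return_set_def by (auto intro!: exI[of _ n])
  qed
  moreover have "open ?U"
  proof (intro open_UN ballI open_INT open_norm_funpow T)
    fix n S assume "S \<in> {S. S \<subseteq> {1..n} \<and> c * real n < real (card S)}"
    then show "finite S" using finite_subset[OF _ finite_atLeastAtMost] by blast
  qed
  ultimately show ?thesis by simp
qed

section \<open>Density of these open sets\<close>

text \<open>A large multiple of \<open>x\<close> has large iterates over any prescribed finite range
  of positive times, because the orbit avoids 0. This property is open, so the orbit of
  \<open>x\<close> itself runs into it.\<close>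

lemma dense_long_excursion_set:
  fixes T :: "'a::banach \<Rightarrow> 'a"
  assumes nontrivial: "\<exists>x::'a. x \<noteq> 0"
    and T: "bounded_linear T" and x: "hypercyclic_vector T x"
  shows "closure (long_excursion_set T n) = UNIV"
proof -
  have "(T ^^ p) x \<in> long_excursion_set T n" for p
  proof -
    \<comment> \<open>The range is lengthened by \<open>p\<close> because T^(m+j) applied to T^p x
      equals T^(j+p) applied to T^m x.\<close>
    define U where "U = (\<Inter>j\<in>{1..n+p}. {v. norm ((T ^^ j) v) > real n})"
    have "open U"
      unfolding U_def
      by (intro open_INT ballI finite_atLeastAtMost open_norm_funpow T)
    moreover have "U \<noteq> {}"
    proof -
      \<comment> \<open>The inserted 1 keeps the minimum defined when
        \<open>n + p = 0\<close>.\<close>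
      define \<mu> where "\<mu> = Min (insert 1 ((\<lambda>j. norm ((T ^^ j) x)) ` {1..n+p}))"
      have \<mu>: "\<mu> > 0"
        unfolding \<mu>_def using hypercyclic_vector_orbit_nonzero[OF nontrivial T x]
        by (subst Min_gr_iff) auto
      define s where "s = (real n + 1) / \<mu>"
      have "real n < norm ((T ^^ j) (s *\<^sub>R x))" if "j \<in> {1..n+p}" for j
      proof -
        have "\<mu> \<le> norm ((T ^^ j) x)" unfolding \<mu>_def using that by (intro Min_le) auto
        then have "s * \<mu> \<le> s * norm ((T ^^ j) x)"
          using \<mu> by (intro mult_left_mono) (auto simp: s_def)
        moreover have "s * \<mu> = real n + 1" "s > 0" using \<mu> by (auto simp: s_def)
        ultimately show ?thesis
          by (simp add: funpow_scaleR[OF bounded_linear.linear[OF T]])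
      qed
      then have "s *\<^sub>R x \<in> U" unfolding U_def by blast
      then show ?thesis by blast
    qed
    ultimately obtain m where m: "(T ^^ m) x \<in> U"
      using x unfolding hypercyclic_vector_def by blast
    have "real n < norm ((T ^^ (m + j)) ((T ^^ p) x))" if "j \<in> {1..n}" for j
    proof -
      have "(T ^^ (m + j)) ((T ^^ p) x) = (T ^^ (j + p)) ((T ^^ m) x)"
        using fun_cong[OF funpow_add[of "m + j" p T], of x]
          fun_cong[OF funpow_add[of "j + p" m T], of x] by (simp add: add_ac)
      moreover have "j + p \<in> {1..n+p}" using that by auto
      ultimately show ?thesis using m unfolding U_def by auto
    qed
    then show ?thesis unfolding long_excursion_set_def by blast
  qed
  then have "range (\<lambda>p. (T ^^ p) x) \<subseteq> long_excursion_set T n" by blast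
  then show ?thesis
    using closure_mono hypercyclic_vector_closure_orbit[OF x] by blast
qed

text \<open>Passing from \<open>x\<close> to its \<open>p\<close>-th iterate shifts the return times
  by \<open>p\<close> and loses at most \<open>p\<close> of them. Halving \<open>c\<close> absorbs
  this loss once \<open>n\<close> is large.\<close>

lemma dense_frequent_return_set:
  assumes x: "hypercyclic_vector T x" and c: "0 < c"
    and dens: "ereal c < upper_density {j. norm ((T ^^ j) x) < a}"
  shows "closure (frequent_return_set T (c / 2) a N) = UNIV"
proof -
  have "(T ^^ p) x \<in> frequent_return_set T (c / 2) a N" for p
  proof -
    \<comment> \<open>The bound \<open>n \<ge> 2 * p / c\<close> makes the loss \<open>p\<close> at
      most \<open>c / 2 * n\<close>.\<close>
    obtain n where n: "n \<ge> max N (nat \<lceil>2 * real p / c\<rceil>)" "0 < n"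
      "c * real n < real (card ({j. norm ((T ^^ j) x) < a} \<inter> {1..n}))"
      using upper_density_gtD[OF dens] by blast
    let ?A = "{j. norm ((T ^^ j) x) < a} \<inter> {1..n}"
    let ?B = "{j. norm ((T ^^ j) ((T ^^ p) x)) < a} \<inter> {1..n}"
    have "?A \<subseteq> {1..p} \<union> (\<lambda>j. j + p) ` ?B"
    proof
      fix i assume i: "i \<in> ?A"
      show "i \<in> {1..p} \<union> (\<lambda>j. j + p) ` ?B"
      proof (cases "i \<le> p")
        case False
        then have "(T ^^ (i - p)) ((T ^^ p) x) = (T ^^ i) x"
          using funpow_add[of "i - p" p T] by simp
        then have "i - p \<in> ?B" using i False by auto
        then show ?thesis using False by (intro UnI2 image_eqI[of _ _ "i - p"]) auto
      qed (use i in auto)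
    qed
    then have "card ?A \<le> card ({1..p} \<union> (\<lambda>j. j + p) ` ?B)" by (intro card_mono) auto
    also have "\<dots> \<le> p + card ?B"
      using card_Un_le[of "{1..p}" "(\<lambda>j. j + p) ` ?B"] card_image_le[of ?B "\<lambda>j. j + p"] by simp
    finally have "real (card ?A) \<le> real p + real (card ?B)" by linarith
    moreover have "2 * real p / c \<le> real n" using n(1) by linarith
    then have "real p \<le> c / 2 * real n" using c by (simp add: field_simps)
    ultimately have "c / 2 * real n < real (card ?B)" using n(3) by (simp add: field_simps)
    then show ?thesis using n unfolding frequent_return_set_def by auto
  qed
  then have "range (\<lambda>p. (T ^^ p) x) \<subseteq> frequent_return_set T (c / 2) a N" by blast
  then show ?thesis
    using closure_mono hypercyclic_vector_closure_orbit[OF x] by blast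
qed

section \<open>The irregular vector and its multiples\<close>

text \<open>The category argument merges hypercyclic vectors chosen separately for each radius into
  a single \<open>x\<close>. The frequency bound survives, at half its size, because it is the same
  for all radii.\<close>

lemma exists_irregular_vector:
  fixes T :: "'a::banach \<Rightarrow> 'a"
  assumes nontrivial: "\<exists>x::'a. x \<noteq> 0"
    and T: "bounded_linear T" and pos: "hc_const T > 0"
  shows "\<exists>x c. c > 0 \<and> (\<forall>n. x \<in> long_excursion_set T n) \<and>
    (\<forall>\<delta>>0. ereal c \<le> upper_density {j. norm ((T ^^ j) x) < \<delta>})"
proof -
  obtain c where c: "c > 0" "ereal c < hc_const T"
    using ereal_dense2[OF pos] by auto
  \<comment> \<open>By \<open>hc_const_radius\<close> one \<open>c\<close> below c(T) serves every
    radius; only the vector depends on \<open>a\<close>.\<close>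
  have ex: "\<exists>x. hypercyclic_vector T x \<and> ereal c < upper_density {j. norm ((T ^^ j) x) < a}"
    if "a > 0" for a
    using c(2) unfolding hc_const_radius[OF bounded_linear.linear[OF T] that] less_SUP_iff
    by (auto simp: HC_def)
  \<comment> \<open>Countably many radii suffice, since the upper density of the return times grows
    with the radius.\<close>
  define F where "F k N = frequent_return_set T (c / 2) (1 / real (Suc k)) N" for k N
  \<comment> \<open>The two families, indexed by \<open>n\<close> and by pairs
    \<open>(k, N)\<close>, are coded into one sequence.\<close>
  define G where "G i = (case sum_decode i of Inl n \<Rightarrow> long_excursion_set T n
    | Inr q \<Rightarrow> (case prod_decode q of (k, N) \<Rightarrow> F k N))" for i
  have "open (G i)" for i
    unfolding G_def F_def
    by (auto split: sum.split prod.split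
        intro: open_long_excursion_set[OF T] open_frequent_return_set[OF T])
  moreover have "closure (G i) = UNIV" for i
  proof (cases "sum_decode i")
    case (Inl n)
    obtain x where "hypercyclic_vector T x" using ex[of 1] by auto
    then show ?thesis
      using dense_long_excursion_set[OF nontrivial T] Inl by (simp add: G_def)
  next
    case (Inr q)
    obtain k N where q: "prod_decode q = (k, N)" by fastforce
    obtain x where "hypercyclic_vector T x"
      "ereal c < upper_density {j. norm ((T ^^ j) x) < 1 / real (Suc k)}"
      using ex[of "1 / real (Suc k)"] by auto
    then show ?thesis
      using dense_frequent_return_set c(1) Inr q by (simp add: G_def F_def)
  qed
  ultimately have "closure (\<Inter>i. G i) = UNIV" by (rule Baire_nat)
  then obtain x where x: "\<And>i. x \<in> G i"
    by (metis INT_E UNIV_I UNIV_not_empty closure_eq_empty ex_in_conv)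
  show ?thesis
  proof (intro exI conjI allI impI)
    show "c / 2 > 0" using c by simp
    show "x \<in> long_excursion_set T n" for n
      using x[of "sum_encode (Inl n)"] by (simp add: G_def)
    fix \<delta> :: real assume "\<delta> > 0"
    then obtain k where k: "1 / real (Suc k) < \<delta>"
      using nat_approx_posE by blast
    have "x \<in> F k N" for N
      using x[of "sum_encode (Inr (prod_encode (k, N)))"] by (simp add: G_def)
    then have "ereal (c / 2) \<le> upper_density {j. norm ((T ^^ j) x) < 1 / real (Suc k)}"
      unfolding F_def frequent_return_set_def by (intro upper_density_geI) (fastforce dest: less_imp_le)
    also have "\<dots> \<le> upper_density {j. norm ((T ^^ j) x) < \<delta>}"
      using k by (intro upper_density_mono) auto
    finally show "ereal (c / 2) \<le> upper_density {j. norm ((T ^^ j) x) < \<delta>}" .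
  qed
qed

theorem theorem2p8:
  fixes T :: "'a::banach \<Rightarrow> 'a"
  assumes nontrivial: "\<exists>x::'a. x \<noteq> 0"
    and "bounded_linear T"
    and "hypercyclic T"
    and "hc_const T > 0"
  shows "reiteratively_distributionally_chaotic_1 T"
proof -
  note T = \<open>bounded_linear T\<close>
  obtain x c where c: "c > 0" and far: "\<And>n. x \<in> long_excursion_set T n"
    and near: "\<And>\<delta>. \<delta> > 0 \<Longrightarrow> ereal c \<le> upper_density {j. norm ((T ^^ j) x) < \<delta>}"
    using exists_irregular_vector[OF nontrivial T \<open>hc_const T > 0\<close>] by auto
  \<comment> \<open>Some iterate of \<open>x\<close> has norm above 1, whereas all iterates of 0
    vanish.\<close>
  have "x \<noteq> 0"
    using far[of 1] linear_0[OF bounded_linear.linear[OF bounded_linear_funpow[OF T]]]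
    by (auto simp: long_excursion_set_def simp del: funpow.simps)
  \<comment> \<open>By linearity the difference of the two orbits is the orbit of \<open>x\<close>
    scaled by \<open>s - t\<close>, so only the threshold changes.\<close>
  have times: "dist_times T (s *\<^sub>R x) (t *\<^sub>R x) \<delta> = {j. norm ((T ^^ j) x) < \<delta> / \<bar>s - t\<bar>}"
    if "s \<noteq> t" for s t \<delta>
  proof -
    have "norm ((T ^^ j) (s *\<^sub>R x) - (T ^^ j) (t *\<^sub>R x)) = \<bar>s - t\<bar> * norm ((T ^^ j) x)" for j
      unfolding funpow_scaleR[OF bounded_linear.linear[OF T]] scaleR_diff_left[symmetric] by simp
    then show ?thesis
      using that unfolding dist_times_def by (simp add: pos_less_divide_eq mult.commute)
  qed
  have BF: "BF T (s *\<^sub>R x) (t *\<^sub>R x) 1 = 0" if "s \<noteq> t" for s t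
    unfolding BF_def
  proof (rule lower_Banach_density_eq_0I)
    fix n
    \<comment> \<open>The distance threshold 1 becomes \<open>1 / \<bar>s - t\<bar>\<close> for
      \<open>x\<close>. An excursion of order \<open>max n k\<close> is long enough for the window
      and high enough for this threshold.\<close>
    obtain k where k: "real k \<ge> 1 / \<bar>s - t\<bar>" using real_arch_simple by blast
    obtain m where m: "\<And>j. j \<in> {1..max n k} \<Longrightarrow> real (max n k) < norm ((T ^^ (m + j)) x)"
      using far[of "max n k"] unfolding long_excursion_set_def by blast
    have "i \<notin> dist_times T (s *\<^sub>R x) (t *\<^sub>R x) 1" if "i \<in> {m+1..m+n}" for i
    proof -
      have "i - m \<in> {1..max n k}" "m + (i - m) = i" using that by (auto simp: le_max_iff_disj)
      then have "real (max n k) < norm ((T ^^ i) x)" using m[of "i - m"] by simp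
      then show ?thesis using k unfolding times[OF \<open>s \<noteq> t\<close>] by auto
    qed
    then show "\<exists>m. dist_times T (s *\<^sub>R x) (t *\<^sub>R x) 1 \<inter> {m+1..m+n} = {}" by blast
  qed
  have F: "ereal c \<le> F_star T (s *\<^sub>R x) (t *\<^sub>R x) \<delta>" if "s \<noteq> t" "\<delta> > 0" for s t \<delta>
    unfolding F_star_def times[OF that(1)] using that by (intro near) simp
  have "inj (\<lambda>s::real. s *\<^sub>R x)" using \<open>x \<noteq> 0\<close> by (simp add: inj_on_def)
  then have "uncountable (range (\<lambda>s::real. s *\<^sub>R x))"
    using uncountable_UNIV_real countable_image_inj_on by blast
  moreover have "\<forall>y\<in>range (\<lambda>s. s *\<^sub>R x). \<forall>z\<in>range (\<lambda>s. s *\<^sub>R x). y \<noteq> z \<longrightarrow>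
      BF T y z 1 = 0 \<and> (\<exists>c>0. \<exists>r>0. \<forall>\<delta>. 0 < \<delta> \<and> \<delta> < r \<longrightarrow> ereal c \<le> F_star T y z \<delta>)"
  proof (intro ballI impI)
    fix y z assume "y \<in> range (\<lambda>s. s *\<^sub>R x)" "z \<in> range (\<lambda>s. s *\<^sub>R x)" "y \<noteq> z"
    then obtain s t where "y = s *\<^sub>R x" "z = t *\<^sub>R x" "s \<noteq> t" by blast
    then show "BF T y z 1 = 0 \<and>
        (\<exists>c>0. \<exists>r>0. \<forall>\<delta>. 0 < \<delta> \<and> \<delta> < r \<longrightarrow> ereal c \<le> F_star T y z \<delta>)"
      \<comment> \<open>The bound \<open>c\<close> is common to all pairs and holds for every
        positive \<open>\<delta>\<close>, so \<open>r = 1\<close> will do.\<close>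
      using BF F c zero_less_one by metis
  qed
  ultimately show ?thesis
    unfolding reiteratively_distributionally_chaotic_1_def
    by (intro exI[of _ "range (\<lambda>s. s *\<^sub>R x)"] exI[of _ 1] conjI zero_less_one)
qed

end
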